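(* Let $l\ge 0$ and let the discrete space be either $V_h^l$ or $W_h^l$. For the semi-discrete discontinuous Galerkin operator $\mathcal{H}^{nonlin}_{i,j}$ of the nonlinear Vlasov–Poisson system, one has $$\sum_{i,j}\mathcal{H}^{nonlin}_{i,j}(f_h,E_h,1)=\Theta(f_h,E_h,1),$$ where $$\Theta(f_h,E_h,\varphi_h)=\sum_i\int_{J_i}(\widehat{E_hf_h}\,\varphi_h)_{x,N_v+\frac12}\,dx-\sum_i\int_{J_i}(\widehat{E_hf_h}\,\varphi_h)_{x,\frac12}\,dx$$ is the contribution of the phase space boundaries $v=\pm V_c$. This implies that the fully discrete scheme (third order TVD Runge–Kutta in time) satisfies $$\sum_{i,j}\int_{I_{i,j}}f_h^{n+1}\,dx\,dv=\sum_{i,j}\int_{I_{i,j}}f_h^{n}\,dx\,dv+\frac23\Delta t\left(\Theta(f_h^{(2)},E_h^{(2)},1)+\frac14\Theta(f_h^{(1)},E_h^{(1)},1)+\frac14\Theta(f_h^{n},E_h^{n},1)\right).$$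
   Context: Equation: the one-dimensional Vlasov–Poisson system $\partial_tf+v f_x-Ef_v=0$, $-\Phi_{xx}=1-\int f\,dv$, $E=-\Phi_x$, periodic in $x\in[0,L]$, with velocity domain truncated to $[-V_c,V_c]$. Mesh: $0=x_{1/2}<x_{3/2}<\dots<x_{N_x+1/2}=L$, $-V_c=v_{1/2}<\dots<v_{N_v+1/2}=V_c$; $J_i=[x_{i-1/2},x_{i+1/2}]$, $K_j=[v_{j-1/2},v_{j+1/2}]$, $I_{i,j}=J_i\times K_j$, $1\le i\le N_x$, $1\le j\le N_v$. The mesh is chosen such that $v$ has a single sign in each $K_j$. All functions of $x$ are extended periodically (traces at $x_{1/2}$ and $x_{N_x+1/2}$ are identified accordingly). Spaces: $V_h^l$ is the set of functions whose restriction to each $I_{i,j}$ lies in $\mathbb{Q}^l=\mathrm{span}\{x^{l_1}v^{l_2}:0\le l_1,l_2\le l\}$; $W_h^l$ is the same with $\mathbb{P}^l=\mathrm{span}\{x^{l_1}v^{l_2}:l_1,l_2\ge0,\ l_1+l_2\le l\}$. Notation: $(\varphi)^\pm_{i+1/2,v}=\lim_{\epsilon\to0^+}\varphi(x_{i+1/2}\pm\epsilon,v)$, $(\varphi)^\pm_{x,j+1/2}=\lim_{\epsilon\to0^+}\varphi(x,v_{j+1/2}\pm\epsilon)$. Upwind fluxes: $\widehat{vf_h}=vf_h^-$ if $v\ge0$ in $K_j$, $\widehat{vf_h}=vf_h^+$ if $v<0$ in $K_j$; $\widehat{E_hf_h}=E_hf_h^-$ if $\int_{J_i}E_h\,dx\le0$,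 $\widehat{E_hf_h}=E_hf_h^+$ if $\int_{J_i}E_h\,dx>0$ (at $v=\pm V_c$ the trace from outside the domain is some prescribed exterior value). Operator: $$\mathcal{H}^{nonlin}_{i,j}(f_h,E_h,\varphi_h)=\int_{I_{i,j}}vf_h(\varphi_h)_x\,dx\,dv-\int_{K_j}(\widehat{vf_h}\varphi_h^-)_{i+\frac12,v}\,dv+\int_{K_j}(\widehat{vf_h}\varphi_h^+)_{i-\frac12,v}\,dv-\int_{I_{i,j}}E_hf_h(\varphi_h)_v\,dx\,dv+\int_{J_i}(\widehat{E_hf_h}\varphi_h^-)_{x,j+\frac12}\,dx-\int_{J_i}(\widehat{E_hf_h}\varphi_h^+)_{x,j-\frac12}\,dx.$$ The semi-discrete scheme seeks $f_h$ in the discrete space with $\int_{I_{i,j}}(f_h)_t\varphi_h\,dx\,dv=\mathcal{H}^{nonlin}_{i,j}(f_h,E_h,\varphi_h)$ for all test functions $\varphi_h$ in the discrete space and all $i,j$. Electric field (exact Poisson solver): with $\rho_h(x,t)=\int_{-V_c}^{V_c}f_h\,dv$, $E_h=C_E+x-\int_0^x\rho_h(z,t)\,dz$, $C_E=-\frac L2+\frac1L\int_0^L\int_0^s\rho_h(z,t)\,dz\,ds$. $E_h^n,E_h^{(1)},E_h^{(2)}$ are obtained in this way from $f_h^n,f_h^{(1)},f_h^{(2)}$. Fully discrete scheme from $t^n$ to $t^{n+1}$ with time step $\Delta t$: for all test functions $\varphi_h$ and all $i,j$, with $\mathcal{H}=\mathcal{H}^{nonlin}$ and integrals over $I_{i,j}$,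 $\int f_h^{(1)}\varphi_h=\int f_h^n\varphi_h+\Delta t\,\mathcal{H}_{i,j}(f_h^n,E_h^n,\varphi_h)$; $\int f_h^{(2)}\varphi_h=\frac34\int f_h^n\varphi_h+\frac14\int f_h^{(1)}\varphi_h+\frac{\Delta t}{4}\mathcal{H}_{i,j}(f_h^{(1)},E_h^{(1)},\varphi_h)$; $\int f_h^{n+1}\varphi_h=\frac13\int f_h^n\varphi_h+\frac23\int f_h^{(2)}\varphi_h+\frac{2\Delta t}{3}\mathcal{H}_{i,j}(f_h^{(2)},E_h^{(2)},\varphi_h)$. No positivity-preserving limiter is used. *)

theory Defs
  imports "HOL-Analysis.Analysis"
begin

text \<open>
  Edges carry half-integer indices in the mathematics; here \<open>xedge M i\<close> is
  \<open>x\<close> at index \<open>i + 1/2\<close> for \<open>0 \<le> i \<le> Nx M\<close>, and \<open>vedge M j\<close> is \<open>v\<close> at index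
  \<open>j + 1/2\<close> for \<open>0 \<le> j \<le> Nv M\<close>. Cells are numbered from 1.
\<close>

record phase_mesh =
  Nx :: nat
  Nv :: nat
  xedge :: "nat \<Rightarrow> real"
  vedge :: "nat \<Rightarrow> real"
  Len :: real
  Vcut :: real

definition Jcell :: "phase_mesh \<Rightarrow> nat \<Rightarrow> real set" where
  "Jcell M i = {xedge M (i - 1)..xedge M i}"

definition Kcell :: "phase_mesh \<Rightarrow> nat \<Rightarrow> real set" where
  "Kcell M j = {vedge M (j - 1)..vedge M j}"

definition Icell :: "phase_mesh \<Rightarrow> nat \<Rightarrow> nat \<Rightarrow> (real \<times> real) set" where
  "Icell M i j = Jcell M i \<times> Kcell M j"

text \<open>
  The cells are closed, so a cell adjacent to \<open>v = 0\<close> contains 0; a single sign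
  therefore means weakly nonnegative or weakly nonpositive.
\<close>

definition valid_mesh :: "phase_mesh \<Rightarrow> bool" where
  "valid_mesh M \<longleftrightarrow>
     1 \<le> Nx M \<and> 1 \<le> Nv M \<and>
     strict_mono_on {0..Nx M} (xedge M) \<and> xedge M 0 = 0 \<and> xedge M (Nx M) = Len M \<and>
     strict_mono_on {0..Nv M} (vedge M) \<and>
     vedge M 0 = - Vcut M \<and> vedge M (Nv M) = Vcut M \<and>
     (\<forall>j\<in>{1..Nv M}. (\<forall>v\<in>Kcell M j. 0 \<le> v) \<or> (\<forall>v\<in>Kcell M j. v \<le> 0))"

definition Qpoly :: "nat \<Rightarrow> (real \<Rightarrow> real \<Rightarrow> real) set" where
  "Qpoly l = {p. \<exists>c :: nat \<Rightarrow> nat \<Rightarrow> real.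
     \<forall>x v. p x v = (\<Sum>a\<le>l. \<Sum>b\<le>l. c a b * x ^ a * v ^ b)}"

definition Ppoly :: "nat \<Rightarrow> (real \<Rightarrow> real \<Rightarrow> real) set" where
  "Ppoly l = {p. \<exists>c :: nat \<Rightarrow> nat \<Rightarrow> real.
     \<forall>x v. p x v = (\<Sum>a\<le>l. \<Sum>b\<le>l - a. c a b * x ^ a * v ^ b)}"

text \<open>
  Piecewise polynomials may jump across cell edges, so only the values in the open
  cells are prescribed; up to null sets all integrals and traces below depend on these
  values only.
  The functions are taken periodically extended in \<open>x\<close>, which makes the outer traces
  at \<open>x = 0\<close> and \<open>x = Len M\<close> ordinary one-sided limits.
\<close>

definition broken_space ::
    "phase_mesh \<Rightarrow> (real \<Rightarrow> real \<Rightarrow> real) set \<Rightarrow> (real \<Rightarrow> real \<Rightarrow> real) set" where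
  "broken_space M P = {f.
     (\<forall>x v. f (x + Len M) v = f x v) \<and>
     (\<forall>i\<in>{1..Nx M}. \<forall>j\<in>{1..Nv M}. \<exists>p\<in>P.
        \<forall>x\<in>interior (Jcell M i). \<forall>v\<in>interior (Kcell M j). f x v = p x v)}"

definition Vh :: "phase_mesh \<Rightarrow> nat \<Rightarrow> (real \<Rightarrow> real \<Rightarrow> real) set" where
  "Vh M l = broken_space M (Qpoly l)"

definition Wh :: "phase_mesh \<Rightarrow> nat \<Rightarrow> (real \<Rightarrow> real \<Rightarrow> real) set" where
  "Wh M l = broken_space M (Ppoly l)"

definition xtr_minus :: "phase_mesh \<Rightarrow> (real \<Rightarrow> real \<Rightarrow> real) \<Rightarrow> nat \<Rightarrow> real \<Rightarrow> real" where
  "xtr_minus M f i v = Lim (at_left (xedge M i)) (\<lambda>x. f x v)"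

definition xtr_plus :: "phase_mesh \<Rightarrow> (real \<Rightarrow> real \<Rightarrow> real) \<Rightarrow> nat \<Rightarrow> real \<Rightarrow> real" where
  "xtr_plus M f i v = Lim (at_right (xedge M i)) (\<lambda>x. f x v)"

definition vtr_minus :: "phase_mesh \<Rightarrow> (real \<Rightarrow> real \<Rightarrow> real) \<Rightarrow> real \<Rightarrow> nat \<Rightarrow> real" where
  "vtr_minus M f x j = Lim (at_left (vedge M j)) (\<lambda>v. f x v)"

definition vtr_plus :: "phase_mesh \<Rightarrow> (real \<Rightarrow> real \<Rightarrow> real) \<Rightarrow> real \<Rightarrow> nat \<Rightarrow> real" where
  "vtr_plus M f x j = Lim (at_right (vedge M j)) (\<lambda>v. f x v)"

definition vflux ::
    "phase_mesh \<Rightarrow> (real \<Rightarrow> real \<Rightarrow> real) \<Rightarrow> nat \<Rightarrow> nat \<Rightarrow> real \<Rightarrow> real" where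
  "vflux M f i j v =
     (if \<forall>w\<in>Kcell M j. 0 \<le> w then v * xtr_minus M f i v else v * xtr_plus M f i v)"

text \<open>
  \<open>g\<close> supplies the exterior trace at the phase space boundaries: \<open>g x (- Vcut M)\<close>
  below \<open>v = - Vcut M\<close> and \<open>g x (Vcut M)\<close> above \<open>v = Vcut M\<close>.
\<close>

definition Eflux ::
    "phase_mesh \<Rightarrow> (real \<Rightarrow> real \<Rightarrow> real) \<Rightarrow> (real \<Rightarrow> real \<Rightarrow> real) \<Rightarrow> (real \<Rightarrow> real) \<Rightarrow>
     nat \<Rightarrow> real \<Rightarrow> nat \<Rightarrow> real" where
  "Eflux M g f E i x j =
     (if integral (Jcell M i) E \<le> 0
      then E x * (if j = 0 then g x (- Vcut M) else vtr_minus M f x j)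
      else E x * (if j = Nv M then g x (Vcut M) else vtr_plus M f x j))"

definition Hnonlin ::
    "phase_mesh \<Rightarrow> (real \<Rightarrow> real \<Rightarrow> real) \<Rightarrow> nat \<Rightarrow> nat \<Rightarrow>
     (real \<Rightarrow> real \<Rightarrow> real) \<Rightarrow> (real \<Rightarrow> real) \<Rightarrow> (real \<Rightarrow> real \<Rightarrow> real) \<Rightarrow> real" where
  "Hnonlin M g i j f E \<phi> =
     integral (Icell M i j) (\<lambda>(x, v). v * f x v * deriv (\<lambda>y. \<phi> y v) x)
     - integral (Kcell M j) (\<lambda>v. vflux M f i j v * xtr_minus M \<phi> i v)
     + integral (Kcell M j) (\<lambda>v. vflux M f (i - 1) j v * xtr_plus M \<phi> (i - 1) v)
     - integral (Icell M i j) (\<lambda>(x, v). E x * f x v * deriv (\<lambda>w. \<phi> x w) v)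
     + integral (Jcell M i) (\<lambda>x. Eflux M g f E i x j * vtr_minus M \<phi> x j)
     - integral (Jcell M i) (\<lambda>x. Eflux M g f E i x (j - 1) * vtr_plus M \<phi> x (j - 1))"

text \<open>
  At the boundaries \<open>v = \<plusminus>Vcut M\<close> the test function enters through its trace from
  inside the domain.
\<close>

definition Theta ::
    "phase_mesh \<Rightarrow> (real \<Rightarrow> real \<Rightarrow> real) \<Rightarrow>
     (real \<Rightarrow> real \<Rightarrow> real) \<Rightarrow> (real \<Rightarrow> real) \<Rightarrow> (real \<Rightarrow> real \<Rightarrow> real) \<Rightarrow> real" where
  "Theta M g f E \<phi> =
     (\<Sum>i=1..Nx M. integral (Jcell M i)
        (\<lambda>x. Eflux M g f E i x (Nv M) * vtr_minus M \<phi> x (Nv M)))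
     - (\<Sum>i=1..Nx M. integral (Jcell M i)
        (\<lambda>x. Eflux M g f E i x 0 * vtr_plus M \<phi> x 0))"

definition rho :: "phase_mesh \<Rightarrow> (real \<Rightarrow> real \<Rightarrow> real) \<Rightarrow> real \<Rightarrow> real" where
  "rho M f x = integral {- Vcut M..Vcut M} (\<lambda>v. f x v)"

definition C_E :: "phase_mesh \<Rightarrow> (real \<Rightarrow> real \<Rightarrow> real) \<Rightarrow> real" where
  "C_E M f = - (Len M / 2)
     + 1 / Len M * integral {0..Len M} (\<lambda>s. integral {0..s} (\<lambda>z. rho M f z))"

text \<open>Only the values of the field for \<open>0 \<le> x \<le> Len M\<close> are meaningful, and only these are used.\<close>

definition Efield :: "phase_mesh \<Rightarrow> (real \<Rightarrow> real \<Rightarrow> real) \<Rightarrow> real \<Rightarrow> real" where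
  "Efield M f x = C_E M f + x - integral {0..x} (\<lambda>z. rho M f z)"

definition cell_pairing ::
    "phase_mesh \<Rightarrow> nat \<Rightarrow> nat \<Rightarrow> (real \<Rightarrow> real \<Rightarrow> real) \<Rightarrow> (real \<Rightarrow> real \<Rightarrow> real) \<Rightarrow> real" where
  "cell_pairing M i j f \<phi> = integral (Icell M i j) (\<lambda>(x, v). f x v * \<phi> x v)"

text \<open>
  One step of the third order TVD Runge-Kutta scheme on the discrete space \<open>S\<close>; the
  exterior data \<open>g0\<close>, \<open>g1\<close>, \<open>g2\<close> may differ between the stages.
\<close>

definition rk3_step ::
    "phase_mesh \<Rightarrow> (real \<Rightarrow> real \<Rightarrow> real) set \<Rightarrow>
     (real \<Rightarrow> real \<Rightarrow> real) \<Rightarrow> (real \<Rightarrow> real \<Rightarrow> real) \<Rightarrow> (real \<Rightarrow> real \<Rightarrow> real) \<Rightarrow> real \<Rightarrow>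
     (real \<Rightarrow> real \<Rightarrow> real) \<Rightarrow> (real \<Rightarrow> real \<Rightarrow> real) \<Rightarrow> (real \<Rightarrow> real \<Rightarrow> real) \<Rightarrow>
     (real \<Rightarrow> real \<Rightarrow> real) \<Rightarrow> bool" where
  "rk3_step M S g0 g1 g2 dt fn f1 f2 fn1 \<longleftrightarrow>
     fn \<in> S \<and> f1 \<in> S \<and> f2 \<in> S \<and> fn1 \<in> S \<and>
     (\<forall>\<phi>\<in>S. \<forall>i\<in>{1..Nx M}. \<forall>j\<in>{1..Nv M}.
        cell_pairing M i j f1 \<phi> =
          cell_pairing M i j fn \<phi> + dt * Hnonlin M g0 i j fn (Efield M fn) \<phi> \<and>
        cell_pairing M i j f2 \<phi> =
          3 / 4 * cell_pairing M i j fn \<phi> + 1 / 4 * cell_pairing M i j f1 \<phi>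
          + dt / 4 * Hnonlin M g1 i j f1 (Efield M f1) \<phi> \<and>
        cell_pairing M i j fn1 \<phi> =
          1 / 3 * cell_pairing M i j fn \<phi> + 2 / 3 * cell_pairing M i j f2 \<phi>
          + 2 * dt / 3 * Hnonlin M g2 i j f2 (Efield M f2) \<phi>)"

end

theory Submission
  imports Defs
begin

text \<open>
  For the test function 1 both volume terms of the operator vanish and every trace of the
  test function is 1, so that a cell contributes nothing but differences of fluxes through
  opposite edges (\<open>Hnonlin_one\<close>). An upwind flux is single-valued: the two cells sharing an
  edge use the same trace there. Hence summation over the mesh telescopes in each direction.
  In \<open>x\<close> the two remaining fluxes, at \<open>x = 0\<close> and \<open>x = L\<close>, agree by periodicity
  (\<open>vflux_periodic\<close>) and cancel; in \<open>v\<close> the two remaining fluxes, at the velocity cut-off,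
  are what \<open>Theta\<close> collects (\<open>sum_Hnonlin_one\<close>).

  For the fully discrete scheme, the constant 1 belongs to both discrete spaces and may be
  tested with in every stage. Each stage then expresses the mass of the new function as an
  affine combination of earlier masses plus a multiple of one boundary term
  (\<open>total_mass_stage\<close>); eliminating the two intermediate masses yields the weights
  \<open>2/3\<close>, \<open>2/3 \<cdot> 1/4\<close> and \<open>2/3 \<cdot> 1/4\<close>. The telescoping concerns the edge integrals themselves
  and never splits an integrand, so that no question of integrability arises, however
  irregular the field and the exterior data may be.
\<close>

lemma one_in_Qpoly: "(\<lambda>x v. 1) \<in> Qpoly l"
proof -
  have "(\<Sum>a\<le>l. \<Sum>b\<le>l. of_bool (a = 0) * of_bool (b = 0) * x ^ a * v ^ b) = 1"
    for x v :: real
    by (simp add: sum.atMost_shift)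
  then show ?thesis
    unfolding Qpoly_def
    by (intro CollectI exI[of _ "\<lambda>a b. of_bool (a = 0) * of_bool (b = 0)"]) simp
qed

lemma one_in_Ppoly: "(\<lambda>x v. 1) \<in> Ppoly l"
proof -
  have "(\<Sum>a\<le>l. \<Sum>b\<le>l - a. of_bool (a = 0) * of_bool (b = 0) * x ^ a * v ^ b) = 1"
    for x v :: real
    by (simp add: sum.atMost_shift)
  then show ?thesis
    unfolding Ppoly_def
    by (intro CollectI exI[of _ "\<lambda>a b. of_bool (a = 0) * of_bool (b = 0)"]) simp
qed

lemma one_in_broken_space:
  assumes "(\<lambda>x v. 1) \<in> P"
  shows "(\<lambda>x v. 1) \<in> broken_space M P"
  using assms by (auto simp: broken_space_def)

lemma Hnonlin_one:
  "Hnonlin M g i j f E (\<lambda>x v. 1) =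
     integral (Jcell M i) (\<lambda>x. Eflux M g f E i x j)
     - integral (Jcell M i) (\<lambda>x. Eflux M g f E i x (j - 1))
     - (integral (Kcell M j) (vflux M f i j) - integral (Kcell M j) (vflux M f (i - 1) j))"
  by (simp add: Hnonlin_def xtr_minus_def xtr_plus_def vtr_minus_def vtr_plus_def
      tendsto_Lim[OF _ tendsto_const])

text \<open>
  The function \<open>h\<close> coincides with its translate by \<open>L\<close>, so it tends to the same values along a
  filter and along the translated filter; \<open>Lim\<close>, which depends on nothing but this set of
  values, agrees even where the limit fails to exist.
\<close>

lemma Lim_filtermap_period:
  fixes h :: "'b::plus \<Rightarrow> 'a::t2_space"
  assumes "\<And>x. h (x + L) = h x"
  shows "Lim (filtermap (\<lambda>x. x + L) F) h = Lim F h"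
  using assms by (simp add: Topological_Spaces.Lim_def filterlim_def filtermap_filtermap)

lemma filtermap_at_left_add: "filtermap (\<lambda>x. x + L) (at_left a) = at_left (a + L)"
  for a L :: real
proof -
  have "nhds (a + L) = filtermap (\<lambda>x. x + L) (nhds a)"
    using filtermap_nhds_shift[of "- L" a] by simp
  then show ?thesis
    by (simp add: filter_eq_iff eventually_filtermap eventually_at_filter)
qed

lemma filtermap_at_right_add: "filtermap (\<lambda>x. x + L) (at_right a) = at_right (a + L)"
  for a L :: real
  using filtermap_at_right_shift[of "- L" a] by simp

lemma vflux_periodic:
  assumes "valid_mesh M" and "\<And>x v. f (x + Len M) v = f x v"
  shows "vflux M f (Nx M) j = vflux M f 0 j"
proof -
  have edges: "xedge M (Nx M) = xedge M 0 + Len M"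
    using assms(1) by (simp add: valid_mesh_def)
  have "xtr_minus M f (Nx M) v = xtr_minus M f 0 v" for v
    using Lim_filtermap_period[of "\<lambda>x. f x v" "Len M" "at_left (xedge M 0)"] assms(2)
    by (simp add: xtr_minus_def edges filtermap_at_left_add)
  moreover have "xtr_plus M f (Nx M) v = xtr_plus M f 0 v" for v
    using Lim_filtermap_period[of "\<lambda>x. f x v" "Len M" "at_right (xedge M 0)"] assms(2)
    by (simp add: xtr_plus_def edges filtermap_at_right_add)
  ultimately show ?thesis
    by (intro ext) (simp only: vflux_def)
qed

text \<open>
  The upwind direction of the \<open>x\<close>-flux depends on the velocity cell alone and that of the
  \<open>v\<close>-flux on the spatial cell alone, so a row of cells along either axis telescopes.
\<close>

lemma sum_Hnonlin_one:
  assumes "valid_mesh M" and "\<And>x v. f (x + Len M) v = f x v"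
  shows "(\<Sum>i=1..Nx M. \<Sum>j=1..Nv M. Hnonlin M g i j f E (\<lambda>x v. 1))
    = Theta M g f E (\<lambda>x v. 1)"
proof -
  define A where "A i j = integral (Jcell M i) (\<lambda>x. Eflux M g f E i x j)" for i j
  define B where "B j i = integral (Kcell M j) (vflux M f i j)" for j i
  have tele: "(\<Sum>k=1..n. h k - h (k - 1)) = h n - h 0" for h :: "nat \<Rightarrow> real" and n
    using sum_telescope''[of 0 n h] by simp
  have "(\<Sum>i=1..Nx M. \<Sum>j=1..Nv M. Hnonlin M g i j f E (\<lambda>x v. 1))
      = (\<Sum>i=1..Nx M. \<Sum>j=1..Nv M. A i j - A i (j - 1))
        - (\<Sum>i=1..Nx M. \<Sum>j=1..Nv M. B j i - B j (i - 1))"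
    by (simp only: Hnonlin_one A_def B_def sum_subtractf)
  also have "(\<Sum>i=1..Nx M. \<Sum>j=1..Nv M. B j i - B j (i - 1))
      = (\<Sum>j=1..Nv M. B j (Nx M) - B j 0)"
    by (subst sum.swap) (simp only: tele)
  also have "\<dots> = 0"
    using vflux_periodic[of M f, OF assms] by (simp add: B_def)
  also have "(\<Sum>i=1..Nx M. \<Sum>j=1..Nv M. A i j - A i (j - 1)) - 0
      = Theta M g f E (\<lambda>x v. 1)"
    by (simp only: tele) (simp add: Theta_def A_def vtr_minus_def vtr_plus_def
        tendsto_Lim[OF _ tendsto_const] sum_subtractf)
  finally show ?thesis .
qed

definition total_mass :: "phase_mesh \<Rightarrow> (real \<Rightarrow> real \<Rightarrow> real) \<Rightarrow> real" where
  "total_mass M f = (\<Sum>i=1..Nx M. \<Sum>j=1..Nv M. integral (Icell M i j) (\<lambda>(x, v). f x v))"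

lemma total_mass_stage:
  assumes "\<And>i j. i \<in> {1..Nx M} \<Longrightarrow> j \<in> {1..Nv M} \<Longrightarrow>
    cell_pairing M i j f (\<lambda>x v. 1) =
      a * cell_pairing M i j p (\<lambda>x v. 1) + b * cell_pairing M i j q (\<lambda>x v. 1) + c * H i j"
  shows "total_mass M f = a * total_mass M p + b * total_mass M q
    + c * (\<Sum>i=1..Nx M. \<Sum>j=1..Nv M. H i j)"
proof -
  have mass: "total_mass M u = (\<Sum>i=1..Nx M. \<Sum>j=1..Nv M. cell_pairing M i j u (\<lambda>x v. 1))" for u
    by (simp add: total_mass_def cell_pairing_def)
  show ?thesis
    unfolding mass sum_distrib_left sum.distrib[symmetric]
    using assms by (intro sum.cong refl) simp
qed

theorem proposition1:
  fixes M :: phase_mesh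
    and l :: nat
    and S :: "(real \<Rightarrow> real \<Rightarrow> real) set"
  assumes "valid_mesh M"
    and "S = Vh M l \<or> S = Wh M l"
  shows "(\<forall>g. \<forall>f\<in>S. \<forall>E.
            (\<Sum>i=1..Nx M. \<Sum>j=1..Nv M. Hnonlin M g i j f E (\<lambda>x v. 1))
              = Theta M g f E (\<lambda>x v. 1))
       \<and> (\<forall>g0 g1 g2 dt fn f1 f2 fn1. 0 < dt \<longrightarrow> rk3_step M S g0 g1 g2 dt fn f1 f2 fn1 \<longrightarrow>
            (\<Sum>i=1..Nx M. \<Sum>j=1..Nv M. integral (Icell M i j) (\<lambda>(x, v). fn1 x v))
              = (\<Sum>i=1..Nx M. \<Sum>j=1..Nv M. integral (Icell M i j) (\<lambda>(x, v). fn x v))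
                + 2 / 3 * dt * (Theta M g2 f2 (Efield M f2) (\<lambda>x v. 1)
                                + 1 / 4 * Theta M g1 f1 (Efield M f1) (\<lambda>x v. 1)
                                + 1 / 4 * Theta M g0 fn (Efield M fn) (\<lambda>x v. 1)))"
proof -
  have one: "(\<lambda>x v. 1) \<in> S"
    using assms(2) by (auto simp: Vh_def Wh_def intro: one_in_broken_space one_in_Qpoly one_in_Ppoly)
  have per: "f (x + Len M) v = f x v" if "f \<in> S" for f x v
    using that assms(2) by (auto simp: Vh_def Wh_def broken_space_def)
  have balance: "(\<Sum>i=1..Nx M. \<Sum>j=1..Nv M. Hnonlin M g i j f E (\<lambda>x v. 1))
      = Theta M g f E (\<lambda>x v. 1)" if "f \<in> S" for g f E
    by (rule sum_Hnonlin_one[OF assms(1)]) (rule per[OF that])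
  have step: "(\<Sum>i=1..Nx M. \<Sum>j=1..Nv M. integral (Icell M i j) (\<lambda>(x, v). fn1 x v))
      = (\<Sum>i=1..Nx M. \<Sum>j=1..Nv M. integral (Icell M i j) (\<lambda>(x, v). fn x v))
        + 2 / 3 * dt * (Theta M g2 f2 (Efield M f2) (\<lambda>x v. 1)
                        + 1 / 4 * Theta M g1 f1 (Efield M f1) (\<lambda>x v. 1)
                        + 1 / 4 * Theta M g0 fn (Efield M fn) (\<lambda>x v. 1))"
    if rk: "rk3_step M S g0 g1 g2 dt fn f1 f2 fn1" for g0 g1 g2 dt fn f1 f2 fn1
  proof -
    have mem: "fn \<in> S" "f1 \<in> S" "f2 \<in> S"
      using rk by (simp_all add: rk3_step_def)
    \<comment> \<open>The first stage involves one earlier mass only; the zero term pads it to the common form.\<close>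
    have "total_mass M f1 = 1 * total_mass M fn + 0 * total_mass M fn
        + dt * Theta M g0 fn (Efield M fn) (\<lambda>x v. 1)"
      unfolding balance[OF mem(1), symmetric]
      by (rule total_mass_stage) (use rk one in \<open>simp add: rk3_step_def\<close>)
    moreover have "total_mass M f2 = 3 / 4 * total_mass M fn + 1 / 4 * total_mass M f1
        + dt / 4 * Theta M g1 f1 (Efield M f1) (\<lambda>x v. 1)"
      unfolding balance[OF mem(2), symmetric]
      by (rule total_mass_stage) (use rk one in \<open>simp add: rk3_step_def\<close>)
    moreover have "total_mass M fn1 = 1 / 3 * total_mass M fn + 2 / 3 * total_mass M f2
        + 2 * dt / 3 * Theta M g2 f2 (Efield M f2) (\<lambda>x v. 1)"
      unfolding balance[OF mem(3), symmetric]
      by (rule total_mass_stage) (use rk one in \<open>simp add: rk3_step_def\<close>)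
    ultimately show ?thesis
      unfolding total_mass_def by (simp add: algebra_simps)
  qed
  show ?thesis
    using balance step by blast
qed

end
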